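(* Let $n\ge2$, let $\mathcal{G}\subseteq\mathrm{GL}_n(\mathbb{Z})$ be the integer representation of the Weyl group of type $\mathrm{C}_n$ with respect to the fundamental weights, and let $\mathcal{T}$, $\mathcal{T}_{\mathbb{R}}$ be its $\mathbb{T}$-orbit space and real $\mathbb{T}$-orbit space. For $1\le i\le n$ put $c_i(z)=(-1)^i\binom{n}{i}z_i\in\mathbb{Q}[z_1,\dots,z_n]$, let \[ C(z)=\begin{bmatrix}0&\cdots&0&-c_n(z)\\1&&0&-c_{n-1}(z)\\&\ddots&&\vdots\\0&&1&-c_1(z)\end{bmatrix}\in\mathbb{Q}[z]^{n\times n} \] be the companion matrix, and define $H\in\mathbb{Q}[z]^{n\times n}$ by $H(z)_{ij}=\mathrm{Tr}\big(C(z)^{i+j-2}-C(z)^{i+j}\big)$. Then \[ \mathcal{T}=\mathcal{T}_{\mathbb{R}}=\{z\in\mathbb{R}^n\mid H(z)\succeq0\}. \]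
   Context: $\mathbb{T}=\{x\in\mathbb{C}\mid|x|=1\}$; $\succeq0$ means positive semidefinite. The matrix $C(z)$ has ones on the first subdiagonal, last column $(-c_n,-c_{n-1},\dots,-c_1)^t$, and zeros elsewhere. The Weyl group $\mathcal{W}\cong\mathfrak{S}_n\ltimes\{\pm1\}^n$ of $\mathrm{C}_n$ acts on $\mathbb{R}^n$ by all signed permutations of coordinates; the fundamental weights are $\omega_i=\epsilon_1+\dots+\epsilon_i$, $1\le i\le n$ ($\epsilon_j$ standard basis vectors of $\mathbb{R}^n$). The integer representation $\mathcal{G}$ is the group of matrices of elements of $\mathcal{W}$ in the basis $\omega_1,\dots,\omega_n$. For $x\in(\mathbb{C}^* )^n$, $\alpha\in\mathbb{Z}^n$, $x^\alpha=\prod x_i^{\alpha_i}$; $\theta_i(x)=\frac1{|\mathcal{G}|}\sum_{B\in\mathcal{G}}x^{Be_i}$ ($e_i$ standard basis of $\mathbb{Z}^n$). The $\mathbb{T}$-orbit space is $\mathcal{T}=\{(\theta_1(x),\dots,\theta_n(x))\mid x\in\mathbb{T}^n\}$. Since $-I_n\in\mathcal{G}$, the $\theta_i$ are real-valued on $\mathbb{T}^n$, and the real $\mathbb{T}$-orbit space $\mathcal{T}_{\mathbb{R}}\subseteq\mathbb{R}^n$ is by definition the image of the same map $x\mapsto(\theta_1(x),\dots,\theta_n(x))$ on $\mathbb{T}^n$. *)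

theory Defs
  imports Complex_Main "Jordan_Normal_Form.Matrix" "HOL-Combinatorics.Permutations"
begin

text \<open>Coordinates, rows and columns are numbered from \<open>0\<close>: the coordinate \<open>z\<^sub>i\<close>, the weight
  \<open>\<omega>\<^sub>i\<close> and the function \<open>\<theta>\<^sub>i\<close> (\<open>1 \<le> i \<le> n\<close>) have index \<open>i - 1\<close> here.\<close>

definition weyl_C :: "nat \<Rightarrow> real mat set" where
  "weyl_C n = {mat n n (\<lambda>(i, j). if i = p j then s j else 0) | p s.
     p permutes {..<n} \<and> (\<forall>j<n. s j \<in> {1, -1})}"

definition fund_weight_C :: "nat \<Rightarrow> nat \<Rightarrow> real vec" where
  "fund_weight_C n i = vec n (\<lambda>k. if k \<le> i then 1 else 0)"

definition fund_weights_mat_C :: "nat \<Rightarrow> real mat" where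
  "fund_weights_mat_C n = mat_of_cols n (map (fund_weight_C n) [0..<n])"

text \<open>\<open>B\<close> is the matrix of \<open>A\<close> in the basis of fundamental weights: the image of the
  \<open>j\<close>-th weight under \<open>A\<close> is the combination of the weights with coefficients in column \<open>j\<close>
  of \<open>B\<close>. Requiring \<open>B\<close> to be integral excludes no element of the Weyl group, see
  \<open>weyl_C_int_rep\<close> below.\<close>

definition int_rep_C :: "nat \<Rightarrow> int mat set" where
  "int_rep_C n = {B \<in> carrier_mat n n. \<exists>A\<in>weyl_C n.
     A * fund_weights_mat_C n = fund_weights_mat_C n * map_mat of_int B}"

definition laurent_monomial :: "complex vec \<Rightarrow> int vec \<Rightarrow> complex" where
  "laurent_monomial x \<alpha> = (\<Prod>i<dim_vec \<alpha>. (x $ i) powi (\<alpha> $ i))"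

definition theta_C :: "nat \<Rightarrow> nat \<Rightarrow> complex vec \<Rightarrow> complex" where
  "theta_C n i x = (1 / of_nat (card (int_rep_C n))) *
     (\<Sum>B\<in>int_rep_C n. laurent_monomial x (B *\<^sub>v unit_vec n i))"

definition torus :: "nat \<Rightarrow> complex vec set" where
  "torus n = {x \<in> carrier_vec n. \<forall>i<n. cmod (x $ i) = 1}"

definition orbit_space_C :: "nat \<Rightarrow> complex vec set" where
  "orbit_space_C n = (\<lambda>x. vec n (\<lambda>i. theta_C n i x)) ` torus n"

definition real_orbit_space_C :: "nat \<Rightarrow> real vec set" where
  "real_orbit_space_C n = {z \<in> carrier_vec n. \<exists>x\<in>torus n. \<forall>i<n. complex_of_real (z $ i) = theta_C n i x}"

definition mat_trace :: "'a :: comm_monoid_add mat \<Rightarrow> 'a" where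
  "mat_trace A = (\<Sum>i<dim_row A. A $$ (i, i))"

definition psd_mat :: "real mat \<Rightarrow> bool" where
  "psd_mat A \<longleftrightarrow> square_mat A \<and> transpose_mat A = A \<and>
     (\<forall>v\<in>carrier_vec (dim_row A). 0 \<le> v \<bullet> (A *\<^sub>v v))"

text \<open>The following three are polymorphic in the ring: taking the coordinates of \<open>z\<close> to be
  indeterminates gives polynomials and polynomial matrices, taking them to be real numbers gives
  the values at a point. In \<open>companion_coeff\<close> the index \<open>i\<close> runs through \<open>1, \<dots>, n\<close>.\<close>

definition companion_coeff :: "nat \<Rightarrow> 'a :: comm_ring_1 vec \<Rightarrow> nat \<Rightarrow> 'a" where
  "companion_coeff n z i = (-1) ^ i * of_nat (n choose i) * z $ (i - 1)"

definition companion_C :: "nat \<Rightarrow> 'a :: comm_ring_1 vec \<Rightarrow> 'a mat" where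
  "companion_C n z = mat n n (\<lambda>(i, j).
     if j = n - 1 then - companion_coeff n z (n - i)
     else if i = j + 1 then 1 else 0)"

text \<open>With rows and columns numbered from \<open>0\<close>, the exponents \<open>i + j - 2\<close> and \<open>i + j\<close> become
  \<open>i + j\<close> and \<open>i + j + 2\<close>.\<close>

definition hermite_mat_C :: "nat \<Rightarrow> 'a :: comm_ring_1 vec \<Rightarrow> 'a mat" where
  "hermite_mat_C n z = mat n n (\<lambda>(i, j).
     mat_trace (companion_C n z ^\<^sub>m (i + j) - companion_C n z ^\<^sub>m (i + j + 2)))"

lemma fund_weights_mat_C_eq:
  "fund_weights_mat_C n = mat n n (\<lambda>(i, j). if i \<le> j then 1 else 0)"
  by (rule eq_matI) (simp_all add: fund_weights_mat_C_def fund_weight_C_def mat_of_cols_def)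

lemma fund_weights_mat_C_inverse:
  fixes n :: nat and D :: "int mat"
  defines "D \<equiv> mat n n (\<lambda>(i, j). if i = j then 1 else if j = i + 1 then -1 else 0)"
  shows "fund_weights_mat_C n * map_mat of_int D = 1\<^sub>m n"
    and "map_mat of_int D * fund_weights_mat_C n = 1\<^sub>m n"
proof -
  show "fund_weights_mat_C n * map_mat of_int D = 1\<^sub>m n"
  proof (rule eq_matI)
    fix i j assume "i < dim_row (1\<^sub>m n)" "j < dim_col (1\<^sub>m n)"
    then have ij: "i < n" "j < n" by auto
    have "(fund_weights_mat_C n * map_mat of_int D) $$ (i, j) =
        (\<Sum>k = 0..<n. (if i \<le> k then 1 else 0) * of_int (if k = j then 1 else if j = k + 1 then -1 else 0))"
      using ij by (simp add: fund_weights_mat_C_eq D_def scalar_prod_def)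
    also have "\<dots> = (\<Sum>k = 0..<n. (if k = j then (if i \<le> j then 1 else 0) else 0) -
        (if k = j - 1 then (if 0 < j \<and> i \<le> j - 1 then 1 else 0) else 0))"
      by (rule sum.cong) auto
    also have "\<dots> = 1\<^sub>m n $$ (i, j)"
      using ij by (simp only: sum_subtractf) (auto simp: sum.delta)
    finally show "(fund_weights_mat_C n * map_mat of_int D) $$ (i, j) = 1\<^sub>m n $$ (i, j)" .
  qed (auto simp: fund_weights_mat_C_eq D_def)
  show "map_mat of_int D * fund_weights_mat_C n = 1\<^sub>m n"
  proof (rule eq_matI)
    fix i j assume "i < dim_row (1\<^sub>m n)" "j < dim_col (1\<^sub>m n)"
    then have ij: "i < n" "j < n" by auto
    have "(map_mat of_int D * fund_weights_mat_C n) $$ (i, j) =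
        (\<Sum>k = 0..<n. of_int (if i = k then 1 else if k = i + 1 then -1 else 0) * (if k \<le> j then 1 else 0))"
      using ij by (simp add: fund_weights_mat_C_eq D_def scalar_prod_def)
    also have "\<dots> = (\<Sum>k = 0..<n. (if k = i then (if i \<le> j then 1 else 0) else 0) -
        (if k = i + 1 then (if i + 1 \<le> j then 1 else 0) else 0))"
      by (rule sum.cong) auto
    also have "\<dots> = 1\<^sub>m n $$ (i, j)"
      using ij by (simp only: sum_subtractf) (auto simp: sum.delta)
    finally show "(map_mat of_int D * fund_weights_mat_C n) $$ (i, j) = 1\<^sub>m n $$ (i, j)" .
  qed (auto simp: fund_weights_mat_C_eq D_def)
qed

lemma weyl_C_int_rep:
  assumes "A \<in> weyl_C n"
  shows "\<exists>!B. B \<in> int_rep_C n \<and>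
    A * fund_weights_mat_C n = fund_weights_mat_C n * map_mat of_int B"
proof -
  let ?W = "fund_weights_mat_C n"
  define D :: "int mat" where
    "D = mat n n (\<lambda>(i, j). if i = j then 1 else if j = i + 1 then -1 else 0)"
  define W :: "int mat" where "W = mat n n (\<lambda>(i, j). if i \<le> j then 1 else 0)"
  obtain p s where A: "A = mat n n (\<lambda>(i, j). if i = p j then s j else 0)"
    and s: "\<forall>j<n. s j \<in> {1, -1}"
    using assms unfolding weyl_C_def by blast
  define A' :: "int mat" where "A' = mat n n (\<lambda>(i, j). if i = p j then \<lfloor>s j\<rfloor> else 0)"
  have s': "of_int \<lfloor>s j\<rfloor> = s j" if "j < n" for j using s that by fastforce
  have AA: "map_mat of_int A' = A" by (rule eq_matI) (auto simp: A A'_def s')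
  have WW: "map_mat of_int W = ?W" by (rule eq_matI) (auto simp: fund_weights_mat_C_eq W_def)
  have c: "A \<in> carrier_mat n n" "?W \<in> carrier_mat n n" "D \<in> carrier_mat n n"
    "A' \<in> carrier_mat n n" "W \<in> carrier_mat n n"
    by (auto simp: A fund_weights_mat_C_eq D_def A'_def W_def)
  note inv = fund_weights_mat_C_inverse[of n, folded D_def]
  let ?B = "D * (A' * W)"
  have h: "map_mat real_of_int ?B = map_mat of_int D * (A * ?W)"
    using c by (simp add: of_int_hom.mat_hom_mult[of _ n n _ n] AA WW)
  have eq: "A * ?W = ?W * map_mat of_int ?B"
    unfolding h using c inv(1)
    by (simp add: assoc_mult_mat[of ?W n n "map_mat of_int D" n "A * ?W" n, symmetric])
  have uniq: "B = ?B" if "B \<in> int_rep_C n" "A * ?W = ?W * map_mat of_int B" for B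
  proof -
    have B: "B \<in> carrier_mat n n" using that by (auto simp: int_rep_C_def)
    have "map_mat real_of_int ?B = map_mat of_int D * (?W * map_mat of_int B)"
      using h that by simp
    also have "\<dots> = map_mat real_of_int B"
      using c B inv(2)
      by (simp add: assoc_mult_mat[of "map_mat of_int D" n n ?W n "map_mat of_int B" n, symmetric])
    finally show ?thesis
      using of_int_hom.mat_hom_inj by metis
  qed
  show ?thesis
    using eq c assms uniq by (intro ex1I[of _ ?B]) (auto simp: int_rep_C_def)
qed

lemma finite_int_rep_C: "finite (int_rep_C n)"
proof -
  let ?W = "fund_weights_mat_C n"
  let ?F = "\<lambda>(p, S). mat n n (\<lambda>(i, j). if i = p j then (if j \<in> S then 1 else -1) else (0 :: real))"
  have "weyl_C n \<subseteq> ?F ` ({p. p permutes {..<n}} \<times> Pow {..<n})"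
  proof
    fix A assume "A \<in> weyl_C n"
    then obtain p s where A: "A = mat n n (\<lambda>(i, j). if i = p j then s j else 0)"
      and p: "p permutes {..<n}" and s: "\<forall>j<n. s j \<in> {1, -1 :: real}"
      unfolding weyl_C_def by blast
    have "A = ?F (p, {j. j < n \<and> s j = 1})" using s by (auto simp: A intro!: eq_matI)
    then show "A \<in> ?F ` ({p. p permutes {..<n}} \<times> Pow {..<n})" using p by blast
  qed
  then have fin: "finite (weyl_C n)"
    by (rule finite_subset) (auto intro: finite_permutations)
  have "int_rep_C n \<subseteq>
      (\<lambda>A. THE B. B \<in> int_rep_C n \<and> A * ?W = ?W * map_mat of_int B) ` weyl_C n"
  proof
    fix B assume B: "B \<in> int_rep_C n"
    then obtain A where A: "A \<in> weyl_C n" "A * ?W = ?W * map_mat of_int B"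
      by (auto simp: int_rep_C_def)
    then have "(THE B. B \<in> int_rep_C n \<and> A * ?W = ?W * map_mat of_int B) = B"
      using B weyl_C_int_rep[OF A(1)] by (intro the1_equality) auto
    then show "B \<in> (\<lambda>A. THE B. B \<in> int_rep_C n \<and> A * ?W = ?W * map_mat of_int B) ` weyl_C n"
      using A(1) by (metis (no_types, lifting) image_eqI)
  qed
  then show ?thesis using fin finite_surj by blast
qed

end

theory Submission
  imports Defs "HOL-Computational_Algebra.Fundamental_Theorem_Algebra"
    "Jordan_Normal_Form.Determinant"
begin

text \<open>In the coordinates \<open>y\<^sub>k = x\<^sub>k / x\<^sub>k\<^sub>-\<^sub>1\<close> dual to the \<open>\<epsilon>\<^sub>k\<close>, averaging over the signs turns
  \<open>\<theta>\<^sub>i\<close> into the average of \<open>u\<^bsub>p 1\<^esub> \<dots> u\<^bsub>p i\<^esub>\<close> over all permutations \<open>p\<close>, where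
  \<open>u\<^sub>k = Re y\<^sub>k \<in> [-1, 1]\<close>; this is the \<open>i\<close>-th elementary symmetric function of \<open>u\<close> divided
  by \<open>n choose i\<close>. So \<open>z\<close> lies in the orbit space iff all the roots of the characteristic
  polynomial of \<open>C(z)\<close> lie in \<open>[-1, 1]\<close>. If \<open>r\<^sub>1, \<dots>, r\<^sub>n\<close> are its complex roots, then \<open>H(z)\<close> is
  the matrix of the quadratic form \<open>q \<mapsto> (\<Sum>k. (1 - r\<^sub>k\<^sup>2) * q(r\<^sub>k)\<^sup>2)\<close> on the polynomials of degree
  less than \<open>n\<close>, and a root outside \<open>[-1, 1]\<close> is detected by a \<open>q\<close> that vanishes at the other
  roots.\<close>

section \<open>Elementary symmetric functions as averages over permutations\<close>

definition esym :: "nat \<Rightarrow> (nat \<Rightarrow> 'a :: comm_ring_1) \<Rightarrow> nat \<Rightarrow> 'a" where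
  "esym n u i = (\<Sum>S | S \<subseteq> {..<n} \<and> card S = i. \<Prod>k\<in>S. u k)"

text \<open>Vieta's formulas: expanding the product chooses the constant term on a subset
  \<open>S\<close> of the factors and the indeterminate on the others; the subsets are then grouped
  by size.\<close>

lemma prod_linear_eq_sum_esym:
  "(\<Prod>k<n. [:- u k, 1:]) = (\<Sum>i\<le>n. monom ((-1) ^ i * esym n u i) (n - i))"
proof -
  have card: "card S \<le> n" if "S \<subseteq> {..<n}" for S
    using card_mono[OF _ that] by simp
  have const: "(\<Prod>k\<in>S. [:- u k:]) = [:(-1) ^ card S * (\<Prod>k\<in>S. u k):]" for S
    by (induction S rule: infinite_finite_induct) (simp_all add: algebra_simps)
  have "(\<Prod>k<n. [:- u k, 1:]) = (\<Prod>k<n. [:- u k:] + monom 1 1)"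
    by (simp add: monom_altdef)
  also have "\<dots> = (\<Sum>S\<in>Pow {..<n}. (\<Prod>k\<in>S. [:- u k:]) * (\<Prod>k\<in>{..<n} - S. monom 1 1))"
    by (rule prod_add) simp
  also have "\<dots> = (\<Sum>S\<in>Pow {..<n}. monom ((-1) ^ card S * (\<Prod>k\<in>S. u k)) (n - card S))"
  proof (rule sum.cong)
    fix S assume "S \<in> Pow {..<n}"
    then have "card ({..<n} - S) = n - card S"
      by (simp add: card_Diff_subset finite_subset)
    then show "(\<Prod>k\<in>S. [:- u k:]) * (\<Prod>k\<in>{..<n} - S. monom 1 1) =
        monom ((-1) ^ card S * (\<Prod>k\<in>S. u k)) (n - card S)"
      by (simp add: const monom_power smult_monom)
  qed simp
  also have "\<dots> = (\<Sum>i\<le>n. \<Sum>S | S \<in> Pow {..<n} \<and> card S = i.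
      monom ((-1) ^ card S * (\<Prod>k\<in>S. u k)) (n - card S))"
    by (rule sum.group[symmetric]) (use card in auto)
  also have "\<dots> = (\<Sum>i\<le>n. monom ((-1) ^ i * esym n u i) (n - i))"
    by (intro sum.cong) (auto simp: esym_def sum_distrib_left monom_sum)
  finally show ?thesis .
qed

lemma esym_0: "esym n u 0 = 1"
proof -
  have "{S. S \<subseteq> {..<n} \<and> card S = 0} = {{}}" by (auto dest: finite_subset)
  then show ?thesis by (simp add: esym_def)
qed

text \<open>A bijection from \<open>S\<close> to \<open>T\<close> and one between their complements,
  which have the same size, glue to a permutation of \<open>A\<close>.\<close>

lemma ex_permutes_image_eq:
  assumes "finite A" "S \<subseteq> A" "T \<subseteq> A" "card S = card T"
  obtains q where "q permutes A" "q ` S = T"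
proof -
  have fin: "finite S" "finite T" using assms finite_subset by blast+
  obtain f where f: "bij_betw f S T"
    using finite_same_card_bij[OF fin assms(4)] by blast
  have "card (A - S) = card (A - T)"
    using assms fin by (simp add: card_Diff_subset)
  then obtain g where g: "bij_betw g (A - S) (A - T)"
    using finite_same_card_bij assms(1) by blast
  define h where "h = (\<lambda>x. if x \<in> S then f x else if x \<in> A then g x else x)"
  have "bij_betw h S T" using f by (subst bij_betw_cong[of _ _ f]) (auto simp: h_def)
  moreover have "bij_betw h (A - S) (A - T)" 
    using g by (subst bij_betw_cong[of _ _ g]) (auto simp: h_def)
  ultimately have "bij_betw h (S \<union> (A - S)) (T \<union> (A - T))"
    by (rule bij_betw_combine) auto
  moreover have "S \<union> (A - S) = A" "T \<union> (A - T) = A" using assms by auto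
  ultimately have "h permutes A"
    using assms(2) by (intro bij_imp_permutes) (auto simp: h_def)
  moreover have "h ` S = T" using \<open>bij_betw h S T\<close> by (simp add: bij_betw_def)
  ultimately show ?thesis using that by blast
qed

text \<open>Double counting over pairs of an \<open>i\<close>-subset \<open>S\<close> and a
  permutation \<open>p\<close>. For fixed \<open>p\<close> the sum over \<open>S\<close> is
  \<open>esym n u i\<close>, since \<open>p\<close> permutes the subsets. For fixed \<open>S\<close>
  the sum over \<open>p\<close> does not depend on \<open>S\<close>, by composing with a permutation
  that takes \<open>{..<i}\<close> to \<open>S\<close>.\<close>

lemma sum_permutes_prod_eq_esym:
  assumes "i \<le> n"
  shows "of_nat (n choose i) * (\<Sum>p | p permutes {..<n}. \<Prod>k<i. u (p k)) = fact n * esym n u i"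
proof -
  let ?P = "{p. p permutes {..<n}}" and ?F = "{S. S \<subseteq> {..<n} \<and> card S = i}"
  have inv: "(\<Sum>S\<in>?F. \<Prod>k\<in>S. u (p k)) = esym n u i" if p: "p permutes {..<n}" for p
  proof -
    have inj: "inj_on p S" for S using permutes_inj_on[OF p] .
    have "inj_on ((`) p) ?F"
      using permutes_inj[OF p] by (simp add: inj_on_def inj_image_eq_iff)
    moreover have "(`) p ` ?F \<subseteq> ?F"
      using permutes_in_image[OF p] by (auto simp: card_image[OF inj])
    ultimately have "bij_betw ((`) p) ?F ?F"
      by (simp add: bij_betw_def endo_inj_surj)
    then have "esym n u i = (\<Sum>S\<in>?F. \<Prod>k\<in>p ` S. u k)"
      unfolding esym_def by (rule sum.reindex_bij_betw[symmetric])
    then show ?thesis by (simp add: prod.reindex[OF inj])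
  qed
  have const: "(\<Sum>p\<in>?P. \<Prod>k\<in>S. u (p k)) = (\<Sum>p\<in>?P. \<Prod>k<i. u (p k))" if "S \<in> ?F" for S
  proof -
    obtain q where q: "q permutes {..<n}" "q ` {..<i} = S"
      using ex_permutes_image_eq[of "{..<n}" "{..<i}" S] assms \<open>S \<in> ?F\<close> by auto
    have "(\<Sum>p\<in>?P. \<Prod>k<i. u (p k)) = (\<Sum>p\<in>?P. \<Prod>k<i. u ((p \<circ> q) k))"
      by (rule sum_permutations_compose_right[OF q(1)])
    also have "\<dots> = (\<Sum>p\<in>?P. \<Prod>k\<in>S. u (p k))"
      by (simp add: q(2)[symmetric] prod.reindex[OF permutes_inj_on[OF q(1)]])
    finally show ?thesis ..
  qed
  have "of_nat (n choose i) * (\<Sum>p\<in>?P. \<Prod>k<i. u (p k)) = (\<Sum>S\<in>?F. \<Sum>p\<in>?P. \<Prod>k\<in>S. u (p k))"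
    using n_subsets[of "{..<n}" i] by (simp add: const)
  also have "\<dots> = (\<Sum>p\<in>?P. \<Sum>S\<in>?F. \<Prod>k\<in>S. u (p k))" by (rule sum.swap)
  also have "\<dots> = fact n * esym n u i"
    by (simp add: inv card_permutations[OF refl])
  finally show ?thesis .
qed

section \<open>The characteristic polynomial of the companion matrix\<close>

text \<open>This is the characteristic polynomial of \<open>companion_C n z\<close>, given by its
  coefficients; the link to the matrix is made in \<open>mat_trace_companion_pow\<close>.\<close>

definition companion_poly :: "nat \<Rightarrow> 'a :: comm_ring_1 vec \<Rightarrow> 'a poly" where
  "companion_poly n z = monom 1 n + (\<Sum>i<n. monom (companion_coeff n z (n - i)) i)"

lemma coeff_companion_poly:
  "coeff (companion_poly n z) i =
    (if i = n then 1 else if i < n then companion_coeff n z (n - i) else 0)"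
  by (simp add: companion_poly_def coeff_sum if_distrib[of "\<lambda>p. coeff p _"])

text \<open>Comparing coefficients by Vieta gives \<open>binom(n, i) * z_i = e_i(u)\<close> for
  \<open>i = 1, ..., n\<close>, and the binomials are invertible in characteristic 0. The right-hand
  side is the form that the functions \<open>theta_C\<close> take below, so this links roots to
  orbits.\<close>

lemma companion_poly_eq_prod_iff:
  fixes z :: "'a :: field_char_0 vec"
  shows "companion_poly n z = (\<Prod>k<n. [:- u k, 1:]) \<longleftrightarrow>
    (\<forall>i<n. z $ i = (\<Sum>p | p permutes {..<n}. \<Prod>k\<le>i. u (p k)) / fact n)"
proof -
  have co: "coeff (\<Prod>k<n. [:- u k, 1:]) j = (if j \<le> n then (-1) ^ (n - j) * esym n u (n - j) else 0)" for j
  proof -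
    have "coeff (\<Prod>k<n. [:- u k, 1:]) j = (\<Sum>i\<le>n. if i = n - j \<and> j \<le> n then (-1) ^ i * esym n u i else 0)"
      unfolding prod_linear_eq_sum_esym coeff_sum by (intro sum.cong) auto
    then show ?thesis by (simp add: sum.delta)
  qed
  have av: "(\<Sum>p | p permutes {..<n}. \<Prod>k\<le>i. u (p k)) / fact n = esym n u (Suc i) / of_nat (n choose Suc i)"
    if "i < n" for i
    using sum_permutes_prod_eq_esym[of "Suc i" n u] that
    by (simp add: field_simps lessThan_Suc_atMost)
  have "companion_poly n z = (\<Prod>k<n. [:- u k, 1:]) \<longleftrightarrow>
    (\<forall>j<n. companion_coeff n z (n - j) = (-1) ^ (n - j) * esym n u (n - j))"
    unfolding poly_eq_iff coeff_companion_poly co by (auto simp: esym_0)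
  also have "\<dots> \<longleftrightarrow> (\<forall>i<n. companion_coeff n z (Suc i) = (-1) ^ Suc i * esym n u (Suc i))"
  proof safe
    fix i assume "\<forall>j<n. companion_coeff n z (n - j) = (-1) ^ (n - j) * esym n u (n - j)" "i < n"
    from this(1)[rule_format, of "n - Suc i"] this(2)
    show "companion_coeff n z (Suc i) = (-1) ^ Suc i * esym n u (Suc i)" by simp
  next
    fix j assume "\<forall>i<n. companion_coeff n z (Suc i) = (-1) ^ Suc i * esym n u (Suc i)" "j < n"
    from this(1)[rule_format, of "n - Suc j"] this(2)
    show "companion_coeff n z (n - j) = (-1) ^ (n - j) * esym n u (n - j)" by (simp add: Suc_diff_Suc)
  qed
  also have "\<dots> \<longleftrightarrow> (\<forall>i<n. z $ i = esym n u (Suc i) / of_nat (n choose Suc i))"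
    by (auto simp: companion_coeff_def field_simps)
  finally show ?thesis by (simp add: av)
qed

section \<open>Traces of companion powers as power sums of the roots\<close>

lemma mat_trace_mult_commute:
  fixes A B :: "'a :: comm_semiring_0 mat"
  assumes "A \<in> carrier_mat n m" "B \<in> carrier_mat m n"
  shows "mat_trace (A * B) = mat_trace (B * A)"
proof -
  have "mat_trace (A * B) = (\<Sum>i<n. \<Sum>j<m. A $$ (i, j) * B $$ (j, i))"
    using assms by (simp add: mat_trace_def scalar_prod_def atLeast0LessThan)
  also have "\<dots> = (\<Sum>j<m. \<Sum>i<n. B $$ (j, i) * A $$ (i, j))"
    by (subst sum.swap) (simp add: mult.commute)
  also have "\<dots> = mat_trace (B * A)"
    using assms by (simp add: mat_trace_def scalar_prod_def atLeast0LessThan)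
  finally show ?thesis .
qed

text \<open>The zeros above the diagonal are part of the claim to make the induction work: in entry
  \<open>(i, j)\<close> of the product, terms with \<open>l > i\<close> vanish by induction and
  those with \<open>l < i\<close> because \<open>T\<close> is lower triangular.\<close>

lemma lower_triangular_pow_diag:
  fixes T :: "'a :: comm_semiring_1 mat"
  assumes T: "T \<in> carrier_mat n n" and lt: "\<And>i j. i < j \<Longrightarrow> j < n \<Longrightarrow> T $$ (i, j) = 0"
    and "i \<le> j" "j < n"
  shows "(T ^\<^sub>m k) $$ (i, j) = (if i = j then (T $$ (i, i)) ^ k else 0)"
  using assms(3,4)
proof (induction k arbitrary: i j)
  case (Suc k)
  have c: "T ^\<^sub>m k \<in> carrier_mat n n" using T by simp
  have "(T ^\<^sub>m Suc k) $$ (i, j) = (\<Sum>l<n. (T ^\<^sub>m k) $$ (i, l) * T $$ (l, j))"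
    using Suc.prems T c by (simp add: scalar_prod_def atLeast0LessThan)
  also have "\<dots> = (\<Sum>l<n. if l = i then (if i = j then T $$ (i, i) ^ Suc k else 0) else 0)"
  proof (rule sum.cong)
    fix l assume l: "l \<in> {..<n}"
    show "(T ^\<^sub>m k) $$ (i, l) * T $$ (l, j) = (if l = i then (if i = j then T $$ (i, i) ^ Suc k else 0) else 0)"
    proof (cases "i \<le> l")
      case True
      then show ?thesis using Suc.IH[OF True] l lt Suc.prems by (auto simp: mult.commute)
    next
      case False
      then show ?thesis using lt[of l j] Suc.prems by simp
    qed
  qed simp
  finally show ?case using Suc.prems by simp
qed (use T in auto)

lemma mat_trace_minus:
  fixes A B :: "'a :: ab_group_add mat"
  assumes "A \<in> carrier_mat n n" "B \<in> carrier_mat n n"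
  shows "mat_trace (A - B) = mat_trace A - mat_trace B"
  using assms by (simp add: mat_trace_def sum_subtractf)

lemma companion_carrier [simp]: "companion_C n z \<in> carrier_mat n n"
  by (simp add: companion_C_def)

lemma degree_prod_linear: "degree (\<Prod>k\<in>S. [:- u k, 1 :: 'a :: field:]) = card S"
  by (subst degree_prod_eq_sum_degree) auto

lemma coeff_card_prod_linear: "coeff (\<Prod>k\<in>S. [:- u k, 1 :: 'a :: field:]) (card S) = 1"
  using lead_coeff_prod[of "\<lambda>k. [:- u k, 1:]" S] by (simp add: degree_prod_linear)

text \<open>On \<open>K[X]/(p)\<close> the companion matrix is multiplication by \<open>X\<close>. In the Newton basis
  \<open>\<Prod>l<k. (X - r\<^sub>l)\<close> it becomes lower bidiagonal with diagonal \<open>r\<close>.\<close>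

lemma mat_trace_companion_pow:
  fixes z :: "'a :: field vec"
  assumes p: "companion_poly n z = (\<Prod>k<n. [:- r k, 1:])"
  shows "mat_trace (companion_C n z ^\<^sub>m k) = (\<Sum>i<n. r i ^ k)"
proof -
  define N where "N k = (\<Prod>l<k. [:- r l, 1:])" for k
  define P where "P = mat n n (\<lambda>(i, j). coeff (N j) i)"
  define T where "T = mat n n (\<lambda>(i, j). if i = j then r j else if i = Suc j then 1 else 0)"
  let ?C = "companion_C n z"
  have degN: "degree (N k) = k" for k by (simp add: N_def degree_prod_linear)
  have N1: "coeff (N k) k = 1" for k 
    using coeff_card_prod_linear[of r "{..<k}"] by (simp add: N_def)
  have N0: "coeff (N k) i = 0" if "k < i" for i k 
    using that by (simp add: coeff_eq_0 degN)
  \<comment> \<open>The two summands are the two nonzero entries in a column of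
    \<open>T\<close>.\<close>
  have step: "pCons 0 (N k) = N (Suc k) + smult (r k) (N k)" for k
    by (simp add: N_def algebra_simps)
  have carr: "P \<in> carrier_mat n n" "T \<in> carrier_mat n n" "?C \<in> carrier_mat n n"
    by (simp_all add: P_def T_def)
  have CP: "?C * P = P * T"
  proof (rule eq_matI)
    fix i j assume "i < dim_row (P * T)" "j < dim_col (P * T)"
    then have ij: "i < n" "j < n" by (simp_all add: P_def T_def)
    then obtain m where m: "n = Suc m" by (cases n) auto
    have "(?C * P) $$ (i, j) = (\<Sum>k<n. ?C $$ (i, k) * coeff (N j) k)"
      using ij by (simp add: companion_C_def P_def scalar_prod_def atLeast0LessThan)
    also have "\<dots> = (\<Sum>k<m. if Suc k = i then coeff (N j) k else 0)
        - companion_coeff n z (n - i) * coeff (N j) m"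
      using ij by (simp add: m companion_C_def) (auto intro!: sum.cong)
    also have "(\<Sum>k<m. if Suc k = i then coeff (N j) k else 0) = coeff (pCons 0 (N j)) i"
      using ij by (cases i) (auto simp: m)
    \<comment> \<open>Only the last basis polynomial \<open>N (n - 1)\<close> has a coefficient at
      degree \<open>n - 1\<close>. There the last column of the matrix subtracts \<open>N n\<close>,
      the companion polynomial itself: reduction modulo that polynomial.\<close>
    also have "companion_coeff n z (n - i) * coeff (N j) m = (if Suc j = n then coeff (N n) i else 0)"
    proof -
      have "companion_coeff n z (n - i) = coeff (N n) i"
        using ij coeff_companion_poly[of n z i] by (simp add: p N_def)
      then show ?thesis using ij N1[of m] N0[of j m] by (cases "j = m") (auto simp: m)
    qed
    also have "coeff (pCons 0 (N j)) i - (if Suc j = n then coeff (N n) i else 0) =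
        (if Suc j < n then coeff (N (Suc j)) i else 0) + r j * coeff (N j) i"
      using ij by (cases "Suc j = n") (auto simp: step)
    also have "\<dots> = (\<Sum>k<n. (if k = Suc j then coeff (N (Suc j)) i else 0)) +
        (\<Sum>k<n. (if k = j then r j * coeff (N j) i else 0))"
      using ij by simp
    also have "\<dots> = (\<Sum>k<n. coeff (N k) i * T $$ (k, j))"
      unfolding sum.distrib[symmetric] using ij by (intro sum.cong) (auto simp: T_def)
    also have "\<dots> = (P * T) $$ (i, j)"
      using ij by (simp add: T_def P_def scalar_prod_def atLeast0LessThan)
    finally show "(?C * P) $$ (i, j) = (P * T) $$ (i, j)" .
  qed (auto simp: P_def T_def companion_C_def)
  have "det P = prod_list (diag_mat P)"
    by (rule det_upper_triangular) (auto simp: P_def N0)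
  also have "diag_mat P = map (\<lambda>i. 1) [0..<n]"
    by (auto simp: diag_mat_def P_def N1)
  finally have "det P \<noteq> 0" by (simp add: map_replicate_const)
  then obtain Q where Q: "Q \<in> carrier_mat n n" "P * Q = 1\<^sub>m n" "Q * P = 1\<^sub>m n"
    using det_non_zero_imp_unit[OF carr(1), of "()"] by (auto simp: Units_def ring_mat_def)
  have "?C = P * T * Q"
    using CP[symmetric] carr Q by (simp add: assoc_mult_mat[OF carr(3,1) Q(1)] right_mult_one_mat[OF carr(3)])
  then have "similar_mat_wit ?C T P Q"
    by (rule similar_mat_witI[OF Q(2,3)]) (use carr Q in auto)
  from similar_mat_wit_pow_id[OF this]
  have "mat_trace (?C ^\<^sub>m k) = mat_trace (P * (T ^\<^sub>m k * Q))"
    using carr Q by (simp add: assoc_mult_mat[of P n n "T ^\<^sub>m k" n Q n])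
  also have "\<dots> = mat_trace (T ^\<^sub>m k * Q * P)"
    using carr Q by (intro mat_trace_mult_commute[of _ n n]) auto
  also have "T ^\<^sub>m k * Q * P = T ^\<^sub>m k"
    using carr Q by (simp add: assoc_mult_mat[of "T ^\<^sub>m k" n n Q n P n])
  also have "mat_trace (T ^\<^sub>m k) = (\<Sum>i<n. (T ^\<^sub>m k) $$ (i, i))"
    using carr by (simp add: mat_trace_def)
  also have "\<dots> = (\<Sum>i<n. r i ^ k)"
  proof (rule sum.cong)
    fix i assume "i \<in> {..<n}"
    moreover have "T $$ (i, j) = 0" if "i < j" "j < n" for i j
      using that by (simp add: T_def)
    ultimately show "(T ^\<^sub>m k) $$ (i, i) = r i ^ k"
      using lower_triangular_pow_diag[OF carr(2), of i i k] by (simp add: T_def)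
  qed simp
  finally show ?thesis .
qed

section \<open>The Hermite quadratic form\<close>

text \<open>By the power sum formula the matrix is \<open>V^t D V\<close>, with \<open>V\<close> the
  Vandermonde matrix of the roots and \<open>D\<close> the diagonal matrix of the
  \<open>1 - r_k^2\<close>. At complex roots the squares are genuine squares, not squared absolute
  values.\<close>

lemma hermite_quadratic_form:
  fixes z :: "'a :: field vec"
  assumes p: "companion_poly n z = (\<Prod>k<n. [:- r k, 1:])" and v: "v \<in> carrier_vec n"
  shows "v \<bullet> (hermite_mat_C n z *\<^sub>v v) = (\<Sum>k<n. (1 - (r k)\<^sup>2) * (\<Sum>i<n. v $ i * r k ^ i)\<^sup>2)"
proof -
  have H: "hermite_mat_C n z $$ (i, j) = (\<Sum>k<n. (1 - (r k)\<^sup>2) * r k ^ i * r k ^ j)"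
    if "i < n" "j < n" for i j
  proof -
    have "hermite_mat_C n z $$ (i, j) = (\<Sum>k<n. r k ^ (i + j)) - (\<Sum>k<n. r k ^ (i + j + 2))"
      using that by (simp add: hermite_mat_C_def mat_trace_minus[of _ n] mat_trace_companion_pow[OF p] del: pow_mat.simps)
    then show ?thesis
      by (simp add: sum_subtractf[symmetric] algebra_simps power_add power2_eq_square)
  qed
  have "v \<bullet> (hermite_mat_C n z *\<^sub>v v) = (\<Sum>i<n. \<Sum>j<n. v $ i * (hermite_mat_C n z $$ (i, j) * v $ j))"
    using v by (simp add: scalar_prod_def atLeast0LessThan hermite_mat_C_def sum_distrib_left)
  also have "\<dots> = (\<Sum>i<n. \<Sum>j<n. \<Sum>k<n. (1 - (r k)\<^sup>2) * ((v $ i * r k ^ i) * (v $ j * r k ^ j)))"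
    by (intro sum.cong refl) (simp add: H sum_distrib_left sum_distrib_right mult_ac)
  also have "\<dots> = (\<Sum>k<n. \<Sum>i<n. \<Sum>j<n. (1 - (r k)\<^sup>2) * ((v $ i * r k ^ i) * (v $ j * r k ^ j)))"
    by (subst (2) sum.swap, subst sum.swap) simp
  also have "\<dots> = (\<Sum>k<n. (1 - (r k)\<^sup>2) * (\<Sum>i<n. v $ i * r k ^ i)\<^sup>2)"
    by (simp only: power2_eq_square sum_product) (simp add: sum_distrib_left)
  finally show ?thesis .
qed

section \<open>From positive semidefiniteness to roots in [-1, 1]\<close>

lemma companion_coeff_of_real:
  assumes "z \<in> carrier_vec n" "0 < i" "i \<le> n"
  shows "companion_coeff n (map_vec complex_of_real z) i = of_real (companion_coeff n z i)"
  using assms by (simp add: companion_coeff_def)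

lemma companion_of_real:
  assumes "z \<in> carrier_vec n"
  shows "companion_C n (map_vec complex_of_real z) = map_mat of_real (companion_C n z)"
  by (rule eq_matI) (auto simp: companion_C_def companion_coeff_of_real[OF assms])

lemma hermite_of_real:
  assumes "z \<in> carrier_vec n"
  shows "hermite_mat_C n (map_vec complex_of_real z) = map_mat of_real (hermite_mat_C n z)"
proof -
  have "mat_trace (map_mat complex_of_real A) = of_real (mat_trace A)" if "A \<in> carrier_mat n n" for A
    using that by (simp add: mat_trace_def)
  then have "mat_trace (map_mat complex_of_real (companion_C n z) ^\<^sub>m k) =
      of_real (mat_trace (companion_C n z ^\<^sub>m k))" for k
    by (simp add: of_real_hom.mat_hom_pow[symmetric, of _ n])
  then show ?thesis
    by (intro eq_matI) (auto simp: hermite_mat_C_def companion_of_real[OF assms] mat_trace_minus[of _ n]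
      simp del: pow_mat.simps)
qed

text \<open>The coefficients are real, so the complex roots are closed under conjugation.\<close>

lemma poly_companion_cnj:
  assumes "z \<in> carrier_vec n"
  shows "poly (companion_poly n (map_vec complex_of_real z)) (cnj w) =
    cnj (poly (companion_poly n (map_vec complex_of_real z)) w)"
  by (simp add: companion_poly_def poly_sum poly_monom companion_coeff_of_real[OF assms])

text \<open>The fundamental theorem of algebra, with the roots numbered and repeated by
  multiplicity.\<close>

lemma ex_roots_complex:
  fixes p :: "complex poly"
  assumes "lead_coeff p = 1"
  obtains r where "p = (\<Prod>k<degree p. [:- r k, 1:])"
proof -
  have "p \<noteq> 0" using assms by auto
  then obtain A where A: "size A = degree p" "p = (\<Prod>x\<in>#A. [:- x, 1:])"
    using alg_closed_imp_factorization[of p] assms by auto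
  obtain xs where xs: "mset xs = A" using ex_mset by blast
  have "p = (\<Prod>x\<leftarrow>xs. [:- x, 1:])"
    unfolding A(2) xs[symmetric] by (simp flip: mset_map prod_mset_prod_list)
  also have "\<dots> = (\<Prod>k<length xs. [:- (xs ! k), 1:])"
    by (simp add: prod.list_conv_set_nth atLeast0LessThan)
  also have "length xs = degree p" using A(1) xs by auto
  finally show ?thesis using that[of "\<lambda>k. xs ! k"] by blast
qed

text \<open>Hermitian extension of the form to complex \<open>q\<close>. Writing
  \<open>q = a + i b\<close> with real polynomials \<open>a\<close> and \<open>b\<close>, the factor
  in \<open>q\<close> is \<open>(a + i b) * (a - i b) = a^2 + b^2\<close> at each root, so the sum
  is the value of the real form at \<open>a\<close> plus that at \<open>b\<close>.\<close>

lemma psd_hermite_complex: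
  assumes z: "z \<in> carrier_vec n" and psd: "psd_mat (hermite_mat_C n z)"
    and r: "companion_poly n (map_vec complex_of_real z) = (\<Prod>k<n. [:- r k, 1:])"
    and q: "degree q < n"
  shows "0 \<le> Re (\<Sum>k<n. (1 - (r k)\<^sup>2) * (poly q (r k) * cnj (poly q (cnj (r k)))))"
proof -
  define a where "a = vec n (\<lambda>i. Re (coeff q i))"
  define b where "b = vec n (\<lambda>i. Im (coeff q i))"
  define ev :: "real vec \<Rightarrow> complex \<Rightarrow> complex" where "ev v w = (\<Sum>i<n. of_real (v $ i) * w ^ i)" for v w
  have nonneg: "0 \<le> Re (\<Sum>k<n. (1 - (r k)\<^sup>2) * (ev v (r k))\<^sup>2)" if v: "v \<in> carrier_vec n" for v
  proof -
    have H: "hermite_mat_C n z \<in> carrier_mat n n" by (simp add: hermite_mat_C_def)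
    have "complex_of_real (v \<bullet> (hermite_mat_C n z *\<^sub>v v)) =
        map_vec of_real v \<bullet> (hermite_mat_C n (map_vec of_real z) *\<^sub>v map_vec of_real v)"
      using v H by (simp add: hermite_of_real[OF z] scalar_prod_def)
    also have "\<dots> = (\<Sum>k<n. (1 - (r k)\<^sup>2) * (ev v (r k))\<^sup>2)"
      using v by (subst hermite_quadratic_form[OF r]) (auto simp: ev_def)
    finally have "Re (\<Sum>k<n. (1 - (r k)\<^sup>2) * (ev v (r k))\<^sup>2) = v \<bullet> (hermite_mat_C n z *\<^sub>v v)"
      by (metis Re_complex_of_real)
    then show ?thesis using psd v by (simp add: psd_mat_def hermite_mat_C_def)
  qed
  have "poly q w = (\<Sum>i<n. coeff q i * w ^ i)" for w
    unfolding poly_altdef using q by (intro sum.mono_neutral_left) (auto simp: coeff_eq_0)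
  then have "poly q w = (\<Sum>i<n. (of_real (a $ i) + \<i> * of_real (b $ i)) * w ^ i)" for w
    by (simp add: a_def b_def flip: complex_eq)
  then have pq: "poly q w = ev a w + \<i> * ev b w" for w
    by (simp add: ev_def sum.distrib sum_distrib_left algebra_simps)
  moreover have "cnj (ev v (cnj w)) = ev v w" for v w by (simp add: ev_def)
  ultimately have "poly q w * cnj (poly q (cnj w)) = (ev a w)\<^sup>2 + (ev b w)\<^sup>2" for w
    by (simp add: algebra_simps power2_eq_square)
  then have "(\<Sum>k<n. (1 - (r k)\<^sup>2) * (poly q (r k) * cnj (poly q (cnj (r k))))) =
      (\<Sum>k<n. (1 - (r k)\<^sup>2) * (ev a (r k))\<^sup>2) + (\<Sum>k<n. (1 - (r k)\<^sup>2) * (ev b (r k))\<^sup>2)"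
    by (simp add: sum.distrib distrib_left)
  then show ?thesis using nonneg[of a] nonneg[of b] by (simp add: a_def b_def)
qed

text \<open>If \<open>x\<close> is a root outside \<open>[-1, 1]\<close>, choose \<open>q\<close> to vanish at all roots other than
  \<open>x\<close> and \<open>cnj x\<close>, with \<open>q x = 1\<close> and, for nonreal \<open>x\<close>, \<open>q (cnj x) = - (1 - x\<^sup>2)\<close>. Then
  each occurrence of \<open>x\<close> or \<open>cnj x\<close> contributes a negative real part to the form.\<close>

lemma psd_hermite_imp_roots:
  assumes z: "z \<in> carrier_vec n" and psd: "psd_mat (hermite_mat_C n z)"
    and r: "companion_poly n (map_vec complex_of_real z) = (\<Prod>k<n. [:- r k, 1:])"
    and k0: "k0 < n"
  shows "r k0 \<in> \<real> \<and> \<bar>Re (r k0)\<bar> \<le> 1"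
proof (rule ccontr)
  assume neg: "\<not> ?thesis"
  define x where "x = r k0"
  let ?R = "r ` {..<n}"
  have root: "poly (companion_poly n (map_vec complex_of_real z)) w = 0 \<longleftrightarrow> w \<in> ?R" for w
    by (auto simp: r poly_prod)
  have x: "x \<in> ?R" "cnj x \<in> ?R"
  proof -
    show "x \<in> ?R" using k0 by (simp add: x_def)
    then show "cnj x \<in> ?R" by (metis poly_companion_cnj[OF z] root complex_cnj_zero)
  qed
  have card: "card ?R \<le> n" using card_image_le[of "{..<n}" r] by simp
  \<comment> \<open>The product runs over the set of roots, so a multiple root costs only one
    degree.\<close>
  define g where "g = (\<Prod>w\<in>?R - {x, cnj x}. [:- w, 1:])"
  have g0: "poly g w = 0 \<longleftrightarrow> w \<in> ?R - {x, cnj x}" for w by (simp add: g_def poly_prod)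
  have degg: "degree g = card (?R - {x, cnj x})" by (simp add: g_def degree_prod_linear)
  obtain q where q: "degree q < n" "poly q x = 1" "\<And>w. w \<in> ?R - {x, cnj x} \<Longrightarrow> poly q w = 0"
    and c: "Re ((1 - x\<^sup>2) * cnj (poly q (cnj x))) < 0"
  proof (cases "x \<in> \<real>")
    case True
    then obtain t where t: "x = of_real t" by (auto elim: Reals_cases)
    have cx: "cnj x = x" by (simp add: t)
    have "1 < \<bar>t\<bar>" using neg True by (simp add: t flip: x_def)
    then have t1: "1 < t\<^sup>2" using one_less_power[of "\<bar>t\<bar>" 2] by simp
    have "poly g x \<noteq> 0" by (simp add: g0)
    moreover have "card (?R - {x, cnj x}) < card ?R"
      using x by (intro psubset_card_mono) auto
    ultimately show ?thesis using card t1
      by (intro that[of "smult (1 / poly g x) g"]) (auto simp: degg g0 cx, simp add: t power2_eq_square)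
  next
    case False
    then have ne: "cnj x \<noteq> x" by (simp add: Reals_cnj_iff)
    have gx: "poly g x \<noteq> 0" "poly g (cnj x) \<noteq> 0" by (simp_all add: g0)
    \<comment> \<open>With this value at \<open>cnj x\<close>, the contribution of \<open>x\<close>
      is minus the squared modulus of \<open>1 - x^2\<close>, which is nonzero because
      \<open>x\<close> is not real.\<close>
    define \<beta> where "\<beta> = - (1 - x\<^sup>2)"
    have "x\<^sup>2 \<noteq> 1" using False by (auto simp: power2_eq_1_iff)
    then have b: "\<beta> \<noteq> 0" by (simp add: \<beta>_def)
    \<comment> \<open>The linear polynomial \<open>l\<close> interpolates the values that
      \<open>l * g\<close> needs at \<open>x\<close> and \<open>cnj x\<close>. Two roots are left
      out of \<open>g\<close>, so its degree still fits below \<open>n\<close>.\<close>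
    define m where "m = (1 / poly g x - \<beta> / poly g (cnj x)) / (x - cnj x)"
    define l where "l = [:1 / poly g x - m * x, m:]"
    have "poly l x = 1 / poly g x" by (simp add: l_def mult.commute)
    moreover have "poly l (cnj x) = \<beta> / poly g (cnj x)"
    proof -
      have "m * (x - cnj x) = 1 / poly g x - \<beta> / poly g (cnj x)" using ne by (simp add: m_def)
      then show ?thesis by (simp add: l_def algebra_simps)
    qed
    ultimately have val: "poly (l * g) x = 1" "poly (l * g) (cnj x) = \<beta>" using gx by simp_all
    have "card (?R - {x, cnj x}) + 2 = card ?R"
      using x ne card_mono[of ?R "{x, cnj x}"] by (simp add: card_Diff_subset)
    moreover have "degree (l * g) \<le> 1 + degree g"
      using degree_mult_le[of l g] by (simp add: l_def split: if_splits)
    ultimately have "degree (l * g) < n" using card degg by linarith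
    moreover have "Re ((1 - x\<^sup>2) * cnj \<beta>) < 0"
    proof -
      have "(1 - x\<^sup>2) * cnj \<beta> = - (\<beta> * cnj \<beta>)" by (simp add: \<beta>_def algebra_simps)
      also have "\<dots> = - of_real ((cmod \<beta>)\<^sup>2)" by (simp only: complex_norm_square)
      finally show ?thesis using b by simp
    qed
    ultimately show ?thesis using val by (intro that[of "l * g"]) (auto simp: g0)
  qed
  define f where "f w = Re ((1 - w\<^sup>2) * (poly q w * cnj (poly q (cnj w))))" for w
  have fx: "f x < 0" using c by (simp add: f_def q)
  \<comment> \<open>Replacing \<open>x\<close> by \<open>cnj x\<close> conjugates the term and so
    keeps its real part.\<close>
  have "f (cnj x) = Re (cnj ((1 - x\<^sup>2) * cnj (poly q (cnj x))))" by (simp add: f_def q)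
  then have fcx: "f (cnj x) < 0" using c by (simp only: cnj.simps(1))
  have "f (r k) \<le> 0" if "k < n" for k
  proof (cases "r k \<in> {x, cnj x}")
    case False
    then show ?thesis using q(3)[of "r k"] that by (simp add: f_def)
  qed (use fx fcx in auto)
  then have "(\<Sum>k<n. f (r k)) < (\<Sum>k<n. 0)"
    using fx k0 by (intro sum_strict_mono_ex1) (auto simp: x_def)
  then show False using psd_hermite_complex[OF z psd r q(1)] by (simp add: f_def)
qed

section \<open>Enumeration of the Weyl group and of its integer representation\<close>

text \<open>The signs are encoded by the set of columns with sign \<open>+1\<close>: a subset of
  \<open>{..<n}\<close> is determined by the matrix, while a sign function on all of
  \<open>nat\<close> is not.\<close>

definition signed_perm_mat :: "nat \<Rightarrow> (nat \<Rightarrow> nat) \<times> nat set \<Rightarrow> real mat" where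
  "signed_perm_mat n = (\<lambda>(p, S). mat n n (\<lambda>(i, j). if i = p j then (if j \<in> S then 1 else -1) else 0))"

lemma bij_betw_signed_perm_mat:
  "bij_betw (signed_perm_mat n) ({p. p permutes {..<n}} \<times> Pow {..<n}) (weyl_C n)"
proof (rule bij_betw_imageI)
  let ?G = "{p. p permutes {..<n}} \<times> Pow {..<n}"
  show "inj_on (signed_perm_mat n) ?G"
  proof (rule inj_onI, clarify)
    fix p S q T assume p: "p permutes {..<n}" and q: "q permutes {..<n}"
      and S: "S \<subseteq> {..<n}" and T: "T \<subseteq> {..<n}"
      and eq: "signed_perm_mat n (p, S) = signed_perm_mat n (q, T)"
    have *: "p j = q j \<and> (j \<in> S \<longleftrightarrow> j \<in> T)" if j: "j < n" for j
    proof -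
      have "p j < n" using permutes_in_image[OF p, of j] j by simp
      then show ?thesis
        \<comment> \<open>The entry \<open>(p j, j)\<close> is nonzero on the left, so on the right
          it forces \<open>q j = p j\<close> and the same sign.\<close>
        using arg_cong[OF eq, of "\<lambda>M. M $$ (p j, j)"] j
        by (auto simp: signed_perm_mat_def split: if_splits)
    qed
    have "p = q"
      using * permutes_not_in[OF p] permutes_not_in[OF q] by (metis lessThan_iff ext)
    moreover have "S = T" using * S T by blast
    ultimately show "p = q \<and> S = T" ..
  qed
  show "signed_perm_mat n ` ?G = weyl_C n"
  proof (intro equalityI subsetI)
    fix A assume "A \<in> signed_perm_mat n ` ?G"
    then obtain p S where "p permutes {..<n}" "A = signed_perm_mat n (p, S)" by auto
    then show "A \<in> weyl_C n" unfolding weyl_C_def signed_perm_mat_def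
      by (auto intro!: exI[of _ p] exI[of _ "\<lambda>j. if j \<in> S then 1 else -1"] split: if_splits)
  next
    fix A assume "A \<in> weyl_C n"
    then obtain p s where A: "A = mat n n (\<lambda>(i, j). if i = p j then s j else 0)"
      and p: "p permutes {..<n}" and s: "\<forall>j<n. s j \<in> {1, -1 :: real}"
      unfolding weyl_C_def by blast
    have "A = signed_perm_mat n (p, {j. j < n \<and> s j = 1})"
      using s by (auto simp: A signed_perm_mat_def intro!: eq_matI)
    then show "A \<in> signed_perm_mat n ` ?G" using p by blast
  qed
qed

text \<open>Change of basis from the standard basis to the fundamental weights. On
  \<open>weyl_C n\<close> the description is well-defined by \<open>weyl_C_int_rep\<close>.\<close>

definition int_rep_of :: "nat \<Rightarrow> real mat \<Rightarrow> int mat" where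
  "int_rep_of n A = (THE B. B \<in> int_rep_C n \<and>
    A * fund_weights_mat_C n = fund_weights_mat_C n * map_mat of_int B)"

lemma int_rep_of:
  assumes "A \<in> weyl_C n"
  shows "int_rep_of n A \<in> int_rep_C n"
    "A * fund_weights_mat_C n = fund_weights_mat_C n * map_mat of_int (int_rep_of n A)"
  using theI'[OF weyl_C_int_rep[OF assms]] by (simp_all add: int_rep_of_def)

lemma bij_betw_int_rep_of: "bij_betw (int_rep_of n) (weyl_C n) (int_rep_C n)"
proof (rule bij_betw_imageI)
  let ?W = "fund_weights_mat_C n"
  obtain D where D: "?W * D = 1\<^sub>m n" "D \<in> carrier_mat n n"
  proof
    show "?W * map_mat of_int (mat n n (\<lambda>(i, j). if i = j then 1 else if j = i + 1 then -1 else 0)) = 1\<^sub>m n"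
      by (rule fund_weights_mat_C_inverse)
  qed simp
  have W: "?W \<in> carrier_mat n n" by (simp add: fund_weights_mat_C_eq)
  show "inj_on (int_rep_of n) (weyl_C n)"
  proof (rule inj_onI)
    fix A A' assume A: "A \<in> weyl_C n" "A' \<in> weyl_C n" and "int_rep_of n A = int_rep_of n A'"
    then have "A * ?W * D = A' * ?W * D" using int_rep_of(2)[of _ n] by metis
    moreover have "A \<in> carrier_mat n n" "A' \<in> carrier_mat n n" using A by (auto simp: weyl_C_def)
    ultimately show "A = A'" using D W by (simp add: assoc_mult_mat[OF _ W D(2)])
  qed
  show "int_rep_of n ` weyl_C n = int_rep_C n"
  proof (intro equalityI subsetI)
    fix B assume B: "B \<in> int_rep_C n"
    then obtain A where A: "A \<in> weyl_C n" "A * ?W = ?W * map_mat of_int B"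
      by (auto simp: int_rep_C_def)
    have "int_rep_of n A = B" unfolding int_rep_of_def
      using B A weyl_C_int_rep[OF A(1)] by (intro the1_equality) auto
    then show "B \<in> int_rep_of n ` weyl_C n" using A(1) by blast
  qed (use int_rep_of in auto)
qed

section \<open>The functions \<open>theta_C\<close> in the coordinates \<open>y\<close>\<close>

lemma power_int_sum:
  fixes y :: "'a :: field"
  assumes "y \<noteq> 0"
  shows "y powi (\<Sum>i\<in>A. f i) = (\<Prod>i\<in>A. y powi f i)"
  by (induction A rule: infinite_finite_induct) (simp_all add: power_int_add assms)

lemma power_int_prod:
  fixes f :: "'b \<Rightarrow> 'a :: field"
  shows "(\<Prod>i\<in>A. f i) powi m = (\<Prod>i\<in>A. f i powi m)"
  by (induction A rule: infinite_finite_induct) (simp_all add: power_int_mult_distrib)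

text \<open>In \<open>x^\<alpha>\<close> the variable \<open>y_j\<close> has exponent
  \<open>\<alpha>_j + ... + \<alpha>_(n-1)\<close>, the \<open>j\<close>-th standard coordinate of
  the combination of weights with coefficients \<open>\<alpha>\<close>. For column \<open>i\<close>
  of the integer matrix this combination is the image of the \<open>i\<close>-th weight, the sum of
  the signed unit vectors at \<open>p l\<close> for \<open>l \<le> i\<close>.\<close>

lemma laurent_monomial_int_rep_of:
  assumes p: "p permutes {..<n}" and i: "i < n"
    and x: "\<And>k. k < n \<Longrightarrow> x $ k = (\<Prod>j\<le>k. y j)" and y: "\<And>j. j < n \<Longrightarrow> y j \<noteq> 0"
    and S: "S \<subseteq> {..<n}"
  shows "laurent_monomial x (int_rep_of n (signed_perm_mat n (p, S)) *\<^sub>v unit_vec n i) =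
    (\<Prod>l\<le>i. if l \<in> S then y (p l) else inverse (y (p l)))"
proof -
  let ?A = "signed_perm_mat n (p, S)" and ?W = "fund_weights_mat_C n"
  let ?B = "int_rep_of n ?A"
  define s :: "nat \<Rightarrow> int" where "s l = (if l \<in> S then 1 else -1)" for l
  have A: "?A \<in> weyl_C n" using bij_betwE[OF bij_betw_signed_perm_mat, of n] p S by blast
  have B: "?B \<in> carrier_mat n n" using int_rep_of(1)[OF A] by (simp add: int_rep_C_def)
  \<comment> \<open>This is entry \<open>(j, i)\<close> of the identity between the Weyl matrix and
    its integer form, whose left side has entries in the \<open>\<epsilon>\<close>
    coordinates.\<close>
  have weight: "(\<Sum>k\<in>{j..<n}. ?B $$ (k, i)) = (\<Sum>l\<le>i. if j = p l then s l else 0)" if j: "j < n" for j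
  proof -
    have "real_of_int (\<Sum>k\<in>{j..<n}. ?B $$ (k, i)) = (\<Sum>k<n. if j \<le> k then of_int (?B $$ (k, i)) else 0)"
      unfolding of_int_sum by (rule sum.mono_neutral_cong_left) auto
    also have "\<dots> = (\<Sum>k<n. (if j \<le> k then 1 else 0) * of_int (?B $$ (k, i)))"
      by (rule sum.cong) auto
    also have "\<dots> = (?W * map_mat of_int ?B) $$ (j, i)"
      using i j B by (simp add: fund_weights_mat_C_eq scalar_prod_def atLeast0LessThan)
    also have "\<dots> = (?A * ?W) $$ (j, i)" by (simp only: int_rep_of(2)[OF A])
    also have "\<dots> = (\<Sum>l<n. (if j = p l then (if l \<in> S then 1 else -1) else 0) * (if l \<le> i then 1 else 0))"
      using i j by (simp add: fund_weights_mat_C_eq signed_perm_mat_def scalar_prod_def atLeast0LessThan)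
    also have "\<dots> = (\<Sum>l\<le>i. of_int (if j = p l then s l else 0))"
      using i by (intro sum.mono_neutral_cong_right) (auto simp: s_def)
    finally show ?thesis by (simp only: of_int_sum[symmetric] of_int_eq_iff)
  qed
  have "laurent_monomial x (?B *\<^sub>v unit_vec n i) = (\<Prod>k<n. (\<Prod>j\<le>k. y j) powi ?B $$ (k, i))"
    unfolding laurent_monomial_def using B i x by (intro prod.cong) simp_all
  also have "\<dots> = (\<Prod>k<n. \<Prod>j<n. if j \<le> k then y j powi ?B $$ (k, i) else 1)"
    unfolding power_int_prod by (intro prod.cong refl prod.mono_neutral_cong_left) auto
  also have "\<dots> = (\<Prod>j<n. \<Prod>k<n. if j \<le> k then y j powi ?B $$ (k, i) else 1)"
    by (rule prod.swap)
  also have "\<dots> = (\<Prod>j<n. y j powi (\<Sum>k\<in>{j..<n}. ?B $$ (k, i)))"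
    by (intro prod.cong refl, subst power_int_sum[OF y])
      (auto intro!: prod.mono_neutral_cong_right)
  also have "\<dots> = (\<Prod>j<n. \<Prod>l\<le>i. if j = p l then y j powi s l else 1)"
    by (intro prod.cong refl) (auto simp: weight power_int_sum[OF y] intro!: prod.cong)
  also have "\<dots> = (\<Prod>l\<le>i. \<Prod>j<n. if j = p l then y j powi s l else 1)"
    by (rule prod.swap)
  also have "\<dots> = (\<Prod>l\<le>i. if l \<in> S then y (p l) else inverse (y (p l)))"
  proof (rule prod.cong)
    fix l assume "l \<in> {..i}"
    then have "p l < n" using i permutes_in_image[OF p, of l] by simp
    then show "(\<Prod>j<n. if j = p l then y j powi s l else 1) =
        (if l \<in> S then y (p l) else inverse (y (p l)))"
      by (simp add: s_def power_int_minus)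
  qed simp
  finally show ?thesis .
qed

text \<open>The sum over all sign choices factors over the indices: each \<open>l \<le> i\<close>
  gives \<open>a l + b l\<close>, and each of the others gives 2.\<close>

lemma sum_Pow_prod:
  fixes a b :: "nat \<Rightarrow> 'a :: field_char_0"
  assumes "i < n"
  shows "(\<Sum>S\<in>Pow {..<n}. \<Prod>l\<le>i. if l \<in> S then a l else b l) = 2 ^ n * (\<Prod>l\<le>i. (a l + b l) / 2)"
proof -
  \<comment> \<open>Padding by 1 above \<open>i\<close> makes all products run over
    \<open>{..<n}\<close>.\<close>
  define f g where "f l = (if l \<le> i then a l else 1)" and "g l = (if l \<le> i then b l else 1)" for l
  have "(\<Sum>S\<in>Pow {..<n}. \<Prod>l\<le>i. if l \<in> S then a l else b l) =
      (\<Sum>S\<in>Pow {..<n}. (\<Prod>l\<in>S. f l) * (\<Prod>l\<in>{..<n} - S. g l))"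
  proof (rule sum.cong)
    fix S assume "S \<in> Pow {..<n}"
    then have S: "{..<n} \<inter> S = S" "{..<n} \<inter> - S = {..<n} - S" by auto
    have "(\<Prod>l\<le>i. if l \<in> S then a l else b l) = (\<Prod>l<n. if l \<in> S then f l else g l)"
      using assms by (intro prod.mono_neutral_cong_left) (auto simp: f_def g_def)
    also have "\<dots> = (\<Prod>l\<in>S. f l) * (\<Prod>l\<in>{..<n} - S. g l)"
      by (simp add: prod.If_cases S)
    finally show "(\<Prod>l\<le>i. if l \<in> S then a l else b l) = (\<Prod>l\<in>S. f l) * (\<Prod>l\<in>{..<n} - S. g l)" .
  qed simp
  also have "\<dots> = (\<Prod>l<n. f l + g l)" by (rule prod_add[symmetric]) simp
  also have "\<dots> = (\<Prod>l<n. 2 * (if l \<le> i then (a l + b l) / 2 else 1))"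
    by (rule prod.cong) (auto simp: f_def g_def)
  also have "\<dots> = 2 ^ n * (\<Prod>l<n. if l \<le> i then (a l + b l) / 2 else 1)"
    by (simp add: prod.distrib)
  also have "(\<Prod>l<n. if l \<le> i then (a l + b l) / 2 else 1) = (\<Prod>l\<le>i. (a l + b l) / 2)"
    using assms by (intro prod.mono_neutral_cong_right) auto
  finally show ?thesis .
qed

text \<open>The group has order \<open>n! * 2^n\<close>. Summing over the signs first turns each
  \<open>y\<close> into the mean of \<open>y\<close> and its inverse, and the powers of 2
  cancel.\<close>

lemma theta_C_eq:
  assumes i: "i < n" and x: "\<And>k. k < n \<Longrightarrow> x $ k = (\<Prod>j\<le>k. y j)" and y: "\<And>j. j < n \<Longrightarrow> y j \<noteq> 0"
  shows "theta_C n i x =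
    (\<Sum>p | p permutes {..<n}. \<Prod>l\<le>i. (y (p l) + inverse (y (p l))) / 2) / fact n"
proof -
  let ?P = "{p. p permutes {..<n}}"
  have bij: "bij_betw (\<lambda>g. int_rep_of n (signed_perm_mat n g)) (?P \<times> Pow {..<n}) (int_rep_C n)"
    using bij_betw_trans[OF bij_betw_signed_perm_mat bij_betw_int_rep_of] by (simp add: o_def)
  have "card (int_rep_C n) = fact n * 2 ^ n"
    using bij_betw_same_card[OF bij] by (simp add: card_cartesian_product card_permutations[OF refl] card_Pow)
  moreover have "(\<Sum>B\<in>int_rep_C n. laurent_monomial x (B *\<^sub>v unit_vec n i)) =
      2 ^ n * (\<Sum>p\<in>?P. \<Prod>l\<le>i. (y (p l) + inverse (y (p l))) / 2)"
  proof -
    have "(\<Sum>B\<in>int_rep_C n. laurent_monomial x (B *\<^sub>v unit_vec n i)) =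
        (\<Sum>(p, S)\<in>?P \<times> Pow {..<n}. \<Prod>l\<le>i. if l \<in> S then y (p l) else inverse (y (p l)))"
      unfolding sum.reindex_bij_betw[OF bij, symmetric]
      by (intro sum.cong) (auto simp: laurent_monomial_int_rep_of[OF _ i x y])
    also have "\<dots> = (\<Sum>p\<in>?P. 2 ^ n * (\<Prod>l\<le>i. (y (p l) + inverse (y (p l))) / 2))"
      unfolding sum.cartesian_product[symmetric] sum_Pow_prod[OF i] ..
    finally show ?thesis by (simp add: sum_distrib_left)
  qed
  ultimately show ?thesis by (simp add: theta_C_def)
qed

text \<open>On the unit circle the inverse is the conjugate, so the mean is the real part.\<close>

lemma theta_C_eq_Re:
  assumes i: "i < n" and x: "\<And>k. k < n \<Longrightarrow> x $ k = (\<Prod>j\<le>k. y j)" and y: "\<And>j. j < n \<Longrightarrow> cmod (y j) = 1"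
  shows "theta_C n i x = of_real ((\<Sum>p | p permutes {..<n}. \<Prod>l\<le>i. Re (y (p l))) / fact n)"
proof -
  have ne: "y j \<noteq> 0" if "j < n" for j using y[OF that] by auto
  have "(y (p l) + inverse (y (p l))) / 2 = of_real (Re (y (p l)))"
    if "p permutes {..<n}" "l \<le> i" for p l
  proof -
    have "p l < n" using permutes_in_image[OF that(1), of l] that(2) i by simp
    then have "inverse (y (p l)) = cnj (y (p l))"
      using divide_conv_cnj[of "y (p l)" 1] y by (simp add: inverse_eq_divide)
    then show ?thesis by (simp add: complex_add_cnj)
  qed
  then show ?thesis by (simp add: theta_C_eq[OF i x ne])
qed

lemma torus_theta_C:
  assumes x: "x \<in> torus n"
  obtains u where "\<And>k. k < n \<Longrightarrow> \<bar>u k\<bar> \<le> 1"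
    "\<And>i. i < n \<Longrightarrow> theta_C n i x = of_real ((\<Sum>p | p permutes {..<n}. \<Prod>l\<le>i. u (p l)) / fact n)"
proof -
  \<comment> \<open>Successive quotients, whose partial products telescope to \<open>x\<close>; the
    case \<open>j = 0\<close> reads the missing predecessor as 1.\<close>
  define y where "y j = (if j = 0 then x $ 0 else x $ j / x $ (j - 1))" for j
  have nx: "cmod (x $ k) = 1" if "k < n" for k using x that by (simp add: torus_def)
  have y: "cmod (y j) = 1" if "j < n" for j using that by (simp add: y_def nx norm_divide)
  have prod: "x $ k = (\<Prod>j\<le>k. y j)" if "k < n" for k using that
  proof (induction k)
    case (Suc k)
    then have "k < n" by simp
    then have "x $ k \<noteq> 0" using nx[of k] by force
    have "(\<Prod>j\<le>Suc k. y j) = x $ k * y (Suc k)" using Suc by simp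
    also have "\<dots> = x $ Suc k" using \<open>x $ k \<noteq> 0\<close> by (simp add: y_def)
    finally show ?case ..
  qed (simp add: y_def)
  show ?thesis
  proof (rule that[of "\<lambda>j. Re (y j)"])
    fix k assume "k < n" then show "\<bar>Re (y k)\<bar> \<le> 1" using abs_Re_le_cmod[of "y k"] y by simp
  qed (rule theta_C_eq_Re[OF _ prod y])
qed

text \<open>Any \<open>u\<close> in the cube arises: the point \<open>cis (arccos u)\<close> of the
  unit circle has real part \<open>u\<close>, and partial products lead back to the torus
  coordinates \<open>x\<close>.\<close>

lemma ex_torus_theta_C:
  assumes u: "\<And>k. k < n \<Longrightarrow> \<bar>u k\<bar> \<le> 1"
  obtains x where "x \<in> torus n"
    "\<And>i. i < n \<Longrightarrow> theta_C n i x = of_real ((\<Sum>p | p permutes {..<n}. \<Prod>l\<le>i. u (p l)) / fact n)"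
proof -
  define y where "y j = cis (arccos (u j))" for j
  define x where "x = vec n (\<lambda>k. \<Prod>j\<le>k. y j)"
  show ?thesis
  proof
    show "x \<in> torus n" by (simp add: torus_def x_def y_def flip: prod_norm)
    fix i assume i: "i < n"
    have "theta_C n i x = of_real ((\<Sum>p | p permutes {..<n}. \<Prod>l\<le>i. Re (y (p l))) / fact n)"
      by (rule theta_C_eq_Re[OF i]) (simp_all add: x_def y_def)
    moreover have "Re (y (p l)) = u (p l)" if "p permutes {..<n}" "l \<le> i" for p l
      using permutes_in_image[OF that(1), of l] that(2) i u[of "p l"] by (simp add: y_def)
    ultimately show "theta_C n i x = of_real ((\<Sum>p | p permutes {..<n}. \<Prod>l\<le>i. u (p l)) / fact n)"
      by simp
  qed
qed

section \<open>The semidefinite description of the orbit space\<close>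

lemma psd_hermite_iff:
  assumes z: "z \<in> carrier_vec n"
  shows "psd_mat (hermite_mat_C n z) \<longleftrightarrow>
    (\<exists>u. (\<forall>k<n. \<bar>u k\<bar> \<le> 1) \<and> companion_poly n z = (\<Prod>k<n. [:- u k, 1:]))"
proof
  assume psd: "psd_mat (hermite_mat_C n z)"
  let ?p = "companion_poly n (map_vec complex_of_real z)"
  have deg: "degree ?p = n"
    by (rule antisym) (auto intro!: degree_le le_degree simp: coeff_companion_poly)
  then have "lead_coeff ?p = 1" by (simp add: coeff_companion_poly)
  then obtain r where r: "?p = (\<Prod>k<n. [:- r k, 1:])"
    using ex_roots_complex[of ?p] deg by metis
  define u where "u k = Re (r k)" for k
  have u: "\<bar>u k\<bar> \<le> 1" "r k = of_real (u k)" if "k < n" for k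
    using psd_hermite_imp_roots[OF z psd r that] by (auto simp: u_def)
  have "?p = (\<Prod>k<n. [:- complex_of_real (u k), 1:])" unfolding r by (simp add: u)
  \<comment> \<open>The factorization descends from complex to real coefficients through the formula
    for the coordinates of \<open>z\<close>.\<close>
  then have "complex_of_real (z $ i) = of_real ((\<Sum>p | p permutes {..<n}. \<Prod>l\<le>i. u (p l)) / fact n)"
    if "i < n" for i using that z by (auto simp: companion_poly_eq_prod_iff)
  then have "companion_poly n z = (\<Prod>k<n. [:- u k, 1:])"
    unfolding companion_poly_eq_prod_iff of_real_eq_iff by blast
  then show "\<exists>u. (\<forall>k<n. \<bar>u k\<bar> \<le> 1) \<and> companion_poly n z = (\<Prod>k<n. [:- u k, 1:])" using u by blast
next
  assume "\<exists>u. (\<forall>k<n. \<bar>u k\<bar> \<le> 1) \<and> companion_poly n z = (\<Prod>k<n. [:- u k, 1:])"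
  then obtain u where u: "\<And>k. k < n \<Longrightarrow> \<bar>u k\<bar> \<le> 1" and p: "companion_poly n z = (\<Prod>k<n. [:- u k, 1:])"
    by blast
  have "0 \<le> v \<bullet> (hermite_mat_C n z *\<^sub>v v)" if "v \<in> carrier_vec n" for v
    unfolding hermite_quadratic_form[OF p that]
    by (intro sum_nonneg mult_nonneg_nonneg) (use u in \<open>auto simp: abs_square_le_1\<close>)
  \<comment> \<open>Symmetry holds because the entry \<open>(i, j)\<close> depends only on
    \<open>i + j\<close>.\<close>
  then show "psd_mat (hermite_mat_C n z)"
    by (auto simp: psd_mat_def hermite_mat_C_def add.commute intro!: eq_matI)
qed

theorem theorem5p3:
  fixes n :: nat
  assumes "n \<ge> 2"
  shows "orbit_space_C n = map_vec complex_of_real ` real_orbit_space_C n \<and>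
    real_orbit_space_C n = {z \<in> carrier_vec n. psd_mat (hermite_mat_C n z)}"
proof
  show "orbit_space_C n = map_vec complex_of_real ` real_orbit_space_C n"
  proof (intro equalityI subsetI)
    fix w assume "w \<in> orbit_space_C n"
    then obtain x where x: "x \<in> torus n" "w = vec n (\<lambda>i. theta_C n i x)"
      by (auto simp: orbit_space_C_def)
    obtain u where "\<And>i. i < n \<Longrightarrow> theta_C n i x =
        of_real ((\<Sum>p | p permutes {..<n}. \<Prod>l\<le>i. u (p l)) / fact n)"
      using torus_theta_C[OF x(1)] by metis
    \<comment> \<open>The functions are real on the torus, so their real parts give the preimage of
      \<open>w\<close>.\<close>
    then have re: "theta_C n i x = of_real (Re (theta_C n i x))" if "i < n" for i
      using that by (metis Re_complex_of_real)
    let ?z = "vec n (\<lambda>i. Re (theta_C n i x))"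
    have "?z \<in> real_orbit_space_C n" using x(1) re by (auto simp: real_orbit_space_C_def)
    moreover have "w = map_vec complex_of_real ?z" using re by (auto simp: x(2))
    ultimately show "w \<in> map_vec complex_of_real ` real_orbit_space_C n" by blast
  next
    fix w assume "w \<in> map_vec complex_of_real ` real_orbit_space_C n"
    then obtain z x where "z \<in> carrier_vec n" "x \<in> torus n" "w = map_vec complex_of_real z"
      "\<forall>i<n. complex_of_real (z $ i) = theta_C n i x"
      by (auto simp: real_orbit_space_C_def)
    then have "w = vec n (\<lambda>i. theta_C n i x)" by auto
    then show "w \<in> orbit_space_C n" using \<open>x \<in> torus n\<close> by (auto simp: orbit_space_C_def)
  qed
  show "real_orbit_space_C n = {z \<in> carrier_vec n. psd_mat (hermite_mat_C n z)}"
  proof (intro equalityI subsetI)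
    fix z assume "z \<in> real_orbit_space_C n"
    then obtain x where z: "z \<in> carrier_vec n" and x: "x \<in> torus n"
      and zx: "\<forall>i<n. complex_of_real (z $ i) = theta_C n i x"
      by (auto simp: real_orbit_space_C_def)
    obtain u where u: "\<And>k. k < n \<Longrightarrow> \<bar>u k\<bar> \<le> 1" "\<And>i. i < n \<Longrightarrow> theta_C n i x =
        of_real ((\<Sum>p | p permutes {..<n}. \<Prod>l\<le>i. u (p l)) / fact n)"
      using torus_theta_C[OF x] by metis
    have "companion_poly n z = (\<Prod>k<n. [:- u k, 1:])"
      unfolding companion_poly_eq_prod_iff using zx u(2) by (metis of_real_eq_iff)
    then show "z \<in> {z \<in> carrier_vec n. psd_mat (hermite_mat_C n z)}"
      using z u(1) by (auto simp: psd_hermite_iff)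
  next
    fix z assume "z \<in> {z \<in> carrier_vec n. psd_mat (hermite_mat_C n z)}"
    then obtain u where z: "z \<in> carrier_vec n" and u: "\<forall>k<n. \<bar>u k\<bar> \<le> 1"
      and "companion_poly n z = (\<Prod>k<n. [:- u k, 1:])"
      by (auto simp: psd_hermite_iff)
    then have zu: "\<forall>i<n. z $ i = (\<Sum>p | p permutes {..<n}. \<Prod>l\<le>i. u (p l)) / fact n"
      by (simp add: companion_poly_eq_prod_iff)
    obtain x where x: "x \<in> torus n" "\<And>i. i < n \<Longrightarrow> theta_C n i x =
        of_real ((\<Sum>p | p permutes {..<n}. \<Prod>l\<le>i. u (p l)) / fact n)"
      using ex_torus_theta_C[of n u] u by metis
    then have "\<forall>i<n. complex_of_real (z $ i) = theta_C n i x" by (simp add: zu)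
    then show "z \<in> real_orbit_space_C n" using z x(1) unfolding real_orbit_space_C_def by blast
  qed
qed

end
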